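(* Define $S_1=(1,2,5)$, $S_2=(701,430,15)$ and, for every $n\ge 2$, let $S_{2n-1}$ and $S_{2n}$ be respectively the first and the second successor of $S_n$ (so $S_3,S_4$ are the successors of $S_2$, $S_5,S_6$ those of $S_3$, $S_7,S_8$ those of $S_4$, and so on). Then this produces an infinite binary tree of pp-solutions of $7x^2+59y^2=3^m$, and the exponents $m$ occurring as third components of the $S_n$, $n\ge1$, form precisely the arithmetic progression $5,15,25,35,45,\ldots$ (i.e. $\{10k+5: k=0,1,2,\ldots\}$). In particular, the equation $7x^2+59y^2=3^m$ possesses infinitely many primitive solutions.
   Context: A solution of $7x^2+59y^2=3^m$ means a triple $(x,y,m)$ of non-zero integers with $m>0$ satisfying the equation. It is primitive if $\gcd(x,y)=1$. A pp-solution is a primitive solution with $x,y>0$. For non-zero integers $p,q$ define $$A(p,q)=59p^2-236pq-7q^2,\qquad B(p,q)=-118p^2-14pq+14q^2.$$ Successors: let $(q,p_0,\omega)$ be a pp-solution, so $7q^2+59p_0^2=3^\omega$ (and $3\nmid p_0q$), and let $p\in\{p_0,-p_0\}$ be such that $pq\equiv-1\pmod 3$. The first successor of $(q,p_0,\omega)$ is $(3^{-5}|A(p,q)|,\,3^{-5}|B(p,q)|,\,2\omega-5)$ and the second successor is $(|A(-p,q)|,\,|B(-p,q)|,\,2\omega+5)$. Both successors of a pp-solution are again pp-solutions. *)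

theory Defs
  imports "HOL-Number_Theory.Cong"
begin

type_synonym triple = "int \<times> int \<times> int"

fun is_solution :: "triple \<Rightarrow> bool" where
  "is_solution (x, y, m) \<longleftrightarrow>
     x \<noteq> 0 \<and> y \<noteq> 0 \<and> m > 0 \<and> 7 * x\<^sup>2 + 59 * y\<^sup>2 = 3 ^ nat m"

fun primitive_solution :: "triple \<Rightarrow> bool" where
  "primitive_solution (x, y, m) \<longleftrightarrow> is_solution (x, y, m) \<and> gcd x y = 1"

fun pp_solution :: "triple \<Rightarrow> bool" where
  "pp_solution (x, y, m) \<longleftrightarrow> primitive_solution (x, y, m) \<and> x > 0 \<and> y > 0"

definition A :: "int \<Rightarrow> int \<Rightarrow> int" where
  "A p q = 59 * p\<^sup>2 - 236 * p * q - 7 * q\<^sup>2"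

definition B :: "int \<Rightarrow> int \<Rightarrow> int" where
  "B p q = - 118 * p\<^sup>2 - 14 * p * q + 14 * q\<^sup>2"

text \<open>For a pp-solution \<open>(q, p\<^sub>0, \<omega>)\<close> neither coordinate is divisible by 3, so exactly one of
  \<open>p\<^sub>0\<close>, \<open>-p\<^sub>0\<close> has product with \<open>q\<close> congruent to \<open>-1\<close> modulo 3.\<close>

definition signed_p :: "int \<Rightarrow> int \<Rightarrow> int" where
  "signed_p q p\<^sub>0 = (if [p\<^sub>0 * q = - 1] (mod 3) then p\<^sub>0 else - p\<^sub>0)"

text \<open>The integer divisions by \<open>3 ^ 5\<close> below are exact on pp-solutions; see
  \<open>first_successor_exact\<close>.\<close>

fun first_successor :: "triple \<Rightarrow> triple" where
  "first_successor (q, p\<^sub>0, \<omega>) =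
     (let p = signed_p q p\<^sub>0 in (\<bar>A p q\<bar> div 3 ^ 5, \<bar>B p q\<bar> div 3 ^ 5, 2 * \<omega> - 5))"

fun second_successor :: "triple \<Rightarrow> triple" where
  "second_successor (q, p\<^sub>0, \<omega>) =
     (let p = signed_p q p\<^sub>0 in (\<bar>A (- p) q\<bar>, \<bar>B (- p) q\<bar>, 2 * \<omega> + 5))"

lemma signed_p_cong:
  assumes "pp_solution (q, p\<^sub>0, \<omega>)"
  shows "[signed_p q p\<^sub>0 * q = - 1] (mod 3)"
proof -
  from assms have eq: "7 * q\<^sup>2 + 59 * p\<^sub>0\<^sup>2 = 3 ^ nat \<omega>" and "\<omega> > 0" and g: "gcd q p\<^sub>0 = 1"
    by auto
  have "(3::int) dvd 3 ^ nat \<omega>"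
    using \<open>\<omega> > 0\<close> by (intro dvd_power) auto
  hence dv: "3 dvd 7 * q\<^sup>2 + 59 * p\<^sub>0\<^sup>2"
    by (simp add: eq)
  obtain a b where ab: "q = 3 * (q div 3) + a" "p\<^sub>0 = 3 * (p\<^sub>0 div 3) + b"
    "a = q mod 3" "b = p\<^sub>0 mod 3" by simp
  have sq: "q\<^sup>2 mod 3 = a\<^sup>2 mod 3" "p\<^sub>0\<^sup>2 mod 3 = b\<^sup>2 mod 3"
    unfolding ab(3,4) by (simp_all add: power_mod)
  have a: "a \<in> {0, 1, 2}" and b: "b \<in> {0, 1, 2}"
    using ab(3,4) by auto
  have nz: "\<not> (a = 0 \<and> b = 0)"
  proof
    assume "a = 0 \<and> b = 0"
    hence "3 dvd q" "3 dvd p\<^sub>0" using ab(3,4) by auto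
    hence "3 dvd gcd q p\<^sub>0" by simp
    with g show False by simp
  qed
  have pr: "(p\<^sub>0 * q) mod 3 = (b * a) mod 3"
    unfolding ab(3,4) by (simp add: mod_mult_eq)
  have "(p\<^sub>0 * q) mod 3 \<noteq> 0"
    using a b nz sq dv unfolding pr by auto presburger+
  hence "(p\<^sub>0 * q) mod 3 = 2 \<or> (- (p\<^sub>0 * q)) mod 3 = 2"
    by presburger
  thus ?thesis
    by (auto simp: signed_p_def cong_def)
qed

lemma pp_solution_exponent_ge:
  assumes "pp_solution (q, p\<^sub>0, \<omega>)"
  shows "\<omega> \<ge> 5"
proof (rule ccontr)
  assume "\<not> ?thesis"
  hence n: "nat \<omega> \<le> 4" by simp
  from assms have eq: "7 * q\<^sup>2 + 59 * p\<^sub>0\<^sup>2 = 3 ^ nat \<omega>" and pos: "q > 0" "p\<^sub>0 > 0"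
    by auto
  from n have "nat \<omega> \<in> {0, 1, 2, 3, 4}" by auto
  hence pw: "(3::int) ^ nat \<omega> \<in> {1, 3, 9, 27, 81}" by auto
  have p: "p\<^sub>0 = 1"
  proof (rule ccontr)
    assume "p\<^sub>0 \<noteq> 1"
    hence "2\<^sup>2 \<le> p\<^sub>0\<^sup>2" using pos by (intro power_mono) auto
    moreover have "0 \<le> q\<^sup>2" by simp
    moreover have "(3::int) ^ nat \<omega> \<le> 81" using pw by auto
    ultimately show False using eq by simp
  qed
  have "0 \<le> q\<^sup>2" by simp
  with p eq pw show False by auto presburger+
qed

lemma first_successor_exact:
  assumes "pp_solution (q, p\<^sub>0, \<omega>)"
  shows "3 ^ 5 dvd A (signed_p q p\<^sub>0) q" "3 ^ 5 dvd B (signed_p q p\<^sub>0) q"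
proof -
  define p where "p = signed_p q p\<^sub>0"
  have pq: "[p * q = - 1] (mod 3)"
    using signed_p_cong[OF assms] by (simp add: p_def)
  have p2: "p\<^sup>2 = p\<^sub>0\<^sup>2" by (simp add: p_def signed_p_def)
  from assms have eq: "7 * q\<^sup>2 + 59 * p\<^sup>2 = 3 ^ nat \<omega>" by (simp add: p2)
  have "5 \<le> nat \<omega>" using pp_solution_exponent_ge[OF assms] by simp
  hence "(3::int) ^ 5 dvd 3 ^ nat \<omega>" by (rule le_imp_power_dvd)
  hence d: "3 ^ 5 dvd 7 * q\<^sup>2 + 59 * p\<^sup>2" by (simp add: eq)
  have "59 * ((p - 2 * q) * (p + 2 * q)) = (7 * q\<^sup>2 + 59 * p\<^sup>2) - 3 ^ 5 * q\<^sup>2"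
    by (simp add: power2_eq_square algebra_simps)
  hence "3 ^ 5 dvd 59 * ((p - 2 * q) * (p + 2 * q))"
    using d by (metis dvd_diff dvd_triv_left)
  moreover have "coprime ((3::int) ^ 5) 59"
    by (simp add: coprime_iff_gcd_eq_1 gcd_non_0_int)
  ultimately have d2: "3 ^ 5 dvd (p - 2 * q) * (p + 2 * q)"
    using coprime_dvd_mult_right_iff by blast
  have n3: "\<not> 3 dvd p + 2 * q"
  proof
    assume "3 dvd p + 2 * q"
    then obtain k where k: "p = 3 * k - 2 * q" by (metis add_diff_cancel_right' dvdE)
    have "p * q = 3 * (k * q - q\<^sup>2) + q\<^sup>2"
      by (simp add: k power2_eq_square algebra_simps)
    hence "q\<^sup>2 mod 3 = 2"
      using pq unfolding cong_def by presburger
    moreover have "q\<^sup>2 mod 3 = (q mod 3)\<^sup>2 mod 3" by (simp add: power_mod)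
    moreover have "q mod 3 \<in> {0, 1, 2}" by auto
    ultimately show False by auto
  qed
  have "coprime (3::int) (p + 2 * q)"
    using n3 by (intro prime_imp_coprime) auto
  hence "coprime ((3::int) ^ 5) (p + 2 * q)" by (rule coprime_power_left_iff[THEN iffD2, OF disjI1])
  with d2 have "3 ^ 5 dvd p - 2 * q"
    using coprime_dvd_mult_left_iff by blast
  then obtain k where "p - 2 * q = 3 ^ 5 * k" by (elim dvdE)
  hence k: "p = 2 * q + 3 ^ 5 * k" by simp
  have "A p q = 3 ^ 5 * (59 * k * (4 * q + 3 ^ 5 * k) - 236 * k * q - q\<^sup>2)"
    by (simp add: A_def k power2_eq_square algebra_simps)
  moreover have "B p q = 3 ^ 5 * (- 118 * k * (4 * q + 3 ^ 5 * k) - 14 * k * q - 2 * q\<^sup>2)"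
    by (simp add: B_def k power2_eq_square algebra_simps)
  ultimately show "3 ^ 5 dvd A (signed_p q p\<^sub>0) q" "3 ^ 5 dvd B (signed_p q p\<^sub>0) q"
    unfolding p_def by simp_all
qed

text \<open>The sequence is indexed from 1; the value at 0 is irrelevant.\<close>

function S :: "nat \<Rightarrow> triple" where
  "S n =
     (if n \<le> 1 then (1, 2, 5)
      else if n = 2 then (701, 430, 15)
      else if odd n then first_successor (S ((n + 1) div 2))
      else second_successor (S (n div 2)))"
  by auto
termination
  by (relation "measure id") auto

declare S.simps [simp del]

lemma S_1: "S 1 = (1, 2, 5)"
  and S_2: "S 2 = (701, 430, 15)"
  by (simp_all add: S.simps)

lemma S_odd: "n \<ge> 2 \<Longrightarrow> S (2 * n - 1) = first_successor (S n)"
  by (subst S.simps) auto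

lemma S_even: "n \<ge> 2 \<Longrightarrow> S (2 * n) = second_successor (S n)"
  by (subst S.simps) auto

text \<open>\<open>T\<close> is the vertex set of a complete infinite binary tree with root \<open>r\<close> and child maps
  \<open>f\<close>, \<open>g\<close>: every vertex is reached from the root by exactly one finite word of child steps.\<close>

definition infinite_binary_tree :: "'a set \<Rightarrow> 'a \<Rightarrow> ('a \<Rightarrow> 'a) \<Rightarrow> ('a \<Rightarrow> 'a) \<Rightarrow> bool" where
  "infinite_binary_tree T r f g \<longleftrightarrow>
     bij_betw (\<lambda>w :: bool list. foldr (\<lambda>b. if b then g else f) w r) UNIV T"

end

theory Submission
  imports Defs
begin

text \<open>
  Attach to a solution \<open>(q, p, \<omega>)\<close> the number \<open>\<alpha> = q\<surd>7 + p\<surd>(-59)\<close>, whose norm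
  \<open>7q\<^sup>2 + 59p\<^sup>2\<close> is \<open>3 ^ \<omega>\<close>. Multiplying \<open>\<alpha>\<^sup>2\<close> by
  \<open>\<surd>7 + 2\<surd>(-59)\<close>, the number attached to \<open>(1, 2, 5)\<close>, gives
  \<open>-A(-p, q)\<surd>7 + B(-p, q)\<surd>(-59)\<close>, of norm \<open>3 ^ (2\<omega> + 5)\<close>. This is the second
  successor. The opposite sign of \<open>p\<close> replaces \<open>\<alpha>\<close> by its conjugate; the product is then
  divisible by \<open>3 ^ 5\<close>, and dividing it out leaves a number of norm \<open>3 ^ (2\<omega> - 5)\<close>, the
  first successor. So successors satisfy the equation by multiplicativity of the norm
  (\<open>norm_A_B\<close>).

  For primitivity, a common divisor of the two coordinates divides a power of 3, so it suffices
  that 3 does not divide one coordinate (\<open>pp_solutionI\<close>). The sign condition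
  \<open>pq \<equiv> -1 (mod 3)\<close> makes both coordinates of each successor nonzero modulo 3, which also
  shows that they do not vanish.

  The exponents come in closed form: \<open>S n\<close> has exponent \<open>10n - 5\<close>, because
  \<open>2(10n - 5) - 5 = 10(2n - 1) - 5\<close> and \<open>2(10n - 5) + 5 = 10(2n) - 5\<close>. Hence the
  exponents form the stated progression and already separate the terms of the sequence. The tree
  property is thereby transferred to the indices, where it says that
  \<open>n \<mapsto> 2n - 1\<close> and \<open>n \<mapsto> 2n\<close> generate every index from 2 in exactly one way
  (\<open>bij_betw_node_index\<close>), i.e. binary expansion of \<open>n - 1\<close>.
\<close>

section \<open>Successors of pp-solutions\<close>

lemma norm_A_B:
  "7 * (A p q)\<^sup>2 + 59 * (B p q)\<^sup>2 = 3 ^ 5 * (7 * q\<^sup>2 + 59 * p\<^sup>2)\<^sup>2"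
  by (simp add: A_def B_def power2_eq_square algebra_simps)

text \<open>Any common divisor of \<open>x\<close> and \<open>y\<close> divides \<open>3 ^ m\<close>, so primitivity can
  only fail at the prime 3.\<close>

lemma pp_solutionI:
  assumes eq: "7 * x\<^sup>2 + 59 * y\<^sup>2 = 3 ^ nat m" and "m > 0"
    and x: "\<not> 3 dvd x" and y: "\<not> 3 dvd y"
  shows "pp_solution (\<bar>x\<bar>, \<bar>y\<bar>, m)"
proof -
  define d where "d = gcd x y"
  have "d dvd x" "d dvd y" by (simp_all add: d_def)
  hence "d dvd 7 * x\<^sup>2 + 59 * y\<^sup>2"
    by (simp add: power2_eq_square)
  hence d: "d dvd 3 ^ nat m" by (simp add: eq)
  have "\<not> 3 dvd d" using x \<open>d dvd x\<close> by (metis dvd_trans)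
  hence "coprime 3 d" by (intro prime_imp_coprime) auto
  hence "coprime (3 ^ nat m) d" by simp
  with d have "is_unit d" by (meson coprime_common_divisor dvd_refl)
  hence "gcd x y = 1" by (simp add: d_def)
  moreover have "x \<noteq> 0" "y \<noteq> 0" using x y by auto
  ultimately show ?thesis using eq \<open>m > 0\<close> by simp
qed

text \<open>Primes divide a square to an even power; at the prime 3 and exponent 5 this supplies the
  extra factor that controls the first successor modulo 3.\<close>

lemma three_power_5_dvd_square:
  fixes t :: int
  assumes "3 ^ 5 dvd t\<^sup>2"
  shows "3 ^ 6 dvd t\<^sup>2"
proof -
  have sq: "3 dvd a" if "3 dvd a\<^sup>2" for a :: int
    using that by (rule prime_dvd_power[rotated]) simp
  have "(3::int) dvd 3 ^ 5" by simp
  hence "3 dvd t\<^sup>2" using assms by (rule dvd_trans)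
  hence "3 dvd t" by (rule sq)
  then obtain u where u: "t = 3 * u" by (elim dvdE)
  have "9 * 27 dvd 9 * u\<^sup>2" using assms by (simp add: u power_mult_distrib)
  hence u2: "27 dvd u\<^sup>2" by (subst (asm) dvd_times_left_cancel_iff) auto
  have "(3::int) dvd 27" by simp
  hence "3 dvd u\<^sup>2" using u2 by (rule dvd_trans)
  hence "3 dvd u" by (rule sq)
  then obtain v where v: "u = 3 * v" by (elim dvdE)
  have "9 * 3 dvd 9 * v\<^sup>2" using u2 by (simp add: v power_mult_distrib)
  hence "3 dvd v\<^sup>2" by (subst (asm) dvd_times_left_cancel_iff) auto
  hence "3 dvd v" by (rule sq)
  then obtain w where w: "v = 3 * w" by (elim dvdE)
  show ?thesis by (simp add: u v w power_mult_distrib)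
qed

lemma signed_p_square [simp]: "(signed_p q p\<^sub>0)\<^sup>2 = p\<^sub>0\<^sup>2"
  by (simp add: signed_p_def)

lemma squares_mod_3_of_mult_cong_minus_1:
  fixes p q :: int
  assumes "[p * q = - 1] (mod 3)"
  shows "p\<^sup>2 mod 3 = 1" "q\<^sup>2 mod 3 = 1"
proof -
  define a b where "a = p mod 3" and "b = q mod 3"
  have "a * b mod 3 = 2"
    using assms by (simp add: a_def b_def cong_def mod_mult_eq)
  moreover have "a \<in> {0, 1, 2}" "b \<in> {0, 1, 2}"
    by (auto simp: a_def b_def)
  ultimately have "a\<^sup>2 mod 3 = 1" "b\<^sup>2 mod 3 = 1" by auto
  thus "p\<^sup>2 mod 3 = 1" "q\<^sup>2 mod 3 = 1" by (simp_all add: a_def b_def power_mod)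
qed

lemma not_3_dvdI:
  fixes x c :: int
  shows "x = 3 * c + 2 \<Longrightarrow> \<not> 3 dvd x" "x = 3 * c + 1 \<Longrightarrow> \<not> 3 dvd x"
  by presburger+

text \<open>Here the condition \<open>pq \<equiv> -1 (mod 3)\<close> rules out a factor 3: with the other
  sign of \<open>p\<close> both values would be divisible by \<open>3 ^ 5\<close>.\<close>

lemma pp_solution_second_successor:
  assumes "pp_solution s"
  shows "pp_solution (second_successor s)"
proof -
  obtain q p0 w where s: "s = (q, p0, w)" by (cases s)
  define p where "p = signed_p q p0"
  have pp: "pp_solution (q, p0, w)" using assms s by simp
  have eq: "7 * q\<^sup>2 + 59 * p\<^sup>2 = 3 ^ nat w" and w: "w > 0"
    using pp by (simp_all add: p_def)
  have pq: "[p * q = - 1] (mod 3)"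
    using signed_p_cong[OF pp] by (simp add: p_def)
  note sq = squares_mod_3_of_mult_cong_minus_1[OF pq]
  have "(p * q) mod 3 = 2" using pq by (simp add: cong_def)
  with sq obtain i j k where ijk: "p\<^sup>2 = 3 * i + 1" "q\<^sup>2 = 3 * j + 1" "p * q = 3 * k + 2"
    by (metis mult_div_mod_eq)
  have "nat (2 * w + 5) = 5 + nat w * 2" using w by simp
  hence "7 * (A (- p) q)\<^sup>2 + 59 * (B (- p) q)\<^sup>2 = 3 ^ nat (2 * w + 5)"
    by (simp only: norm_A_B power2_minus eq power_add power_mult)
  \<comment> \<open>Since \<open>p\<^sup>2 = q\<^sup>2 = 1\<close> and \<open>pq = 2\<close> modulo 3, both values are 2 modulo 3.\<close>
  moreover have "A (- p) q = 59 * p\<^sup>2 + 236 * (p * q) - 7 * q\<^sup>2"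
    by (simp add: A_def)
  hence "A (- p) q = 3 * (59 * i + 236 * k - 7 * j + 174) + 2" by (simp add: ijk)
  hence "\<not> 3 dvd A (- p) q" by (rule not_3_dvdI)
  moreover have "B (- p) q = - 118 * p\<^sup>2 + 14 * (p * q) + 14 * q\<^sup>2"
    by (simp add: B_def)
  hence "B (- p) q = 3 * (14 * k + 14 * j - 118 * i - 26) + 2" by (simp add: ijk)
  hence "\<not> 3 dvd B (- p) q" by (rule not_3_dvdI)
  ultimately have "pp_solution (\<bar>A (- p) q\<bar>, \<bar>B (- p) q\<bar>, 2 * w + 5)"
    using w by (intro pp_solutionI) auto
  thus ?thesis by (simp add: s p_def Let_def del: pp_solution.simps)
qed

text \<open>With \<open>t = p - 2q\<close> one has \<open>A = 59t\<^sup>2 - 3\<^sup>5q\<^sup>2\<close> and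
  \<open>B = -2A - 2\<cdot>3\<^sup>5pq\<close>. As \<open>3\<^sup>5\<close> divides \<open>A\<close>, it divides \<open>t\<^sup>2\<close>, so even
  \<open>3\<^sup>6\<close> does. Modulo 3 the quotients of \<open>A\<close> and \<open>B\<close> by \<open>3\<^sup>5\<close> are therefore
  \<open>-q\<^sup>2 = -1\<close> and \<open>2 - 2pq = 1\<close>.\<close>

lemma pp_solution_first_successor:
  assumes "pp_solution s"
  shows "pp_solution (first_successor s)"
proof -
  obtain q p0 w where s: "s = (q, p0, w)" by (cases s)
  define p where "p = signed_p q p0"
  have pp: "pp_solution (q, p0, w)" using assms s by simp
  have eq: "7 * q\<^sup>2 + 59 * p\<^sup>2 = 3 ^ nat w"
    using pp by (simp add: p_def)
  have w: "w \<ge> 5" by (rule pp_solution_exponent_ge[OF pp])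
  have pq: "[p * q = - 1] (mod 3)"
    using signed_p_cong[OF pp] by (simp add: p_def)
  have q2: "q\<^sup>2 mod 3 = 1" by (rule squares_mod_3_of_mult_cong_minus_1[OF pq])
  have "(p * q) mod 3 = 2" using pq by (simp add: cong_def)
  with q2 obtain i j where ij: "q\<^sup>2 = 3 * i + 1" "p * q = 3 * j + 2"
    by (metis mult_div_mod_eq)
  obtain a b where a: "A p q = 3 ^ 5 * a" and b: "B p q = 3 ^ 5 * b"
    using first_successor_exact[OF pp] unfolding p_def dvd_def by blast

  have A_eq: "59 * (p - 2 * q)\<^sup>2 = A p q + 3 ^ 5 * q\<^sup>2"
    by (simp add: A_def power2_eq_square algebra_simps)
  hence "3 ^ 5 dvd 59 * (p - 2 * q)\<^sup>2" by (simp add: a)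
  moreover have "coprime ((3::int) ^ 5) 59"
    by (simp add: coprime_iff_gcd_eq_1 gcd_non_0_int)
  ultimately have "3 ^ 5 dvd (p - 2 * q)\<^sup>2"
    using coprime_dvd_mult_right_iff by blast
  then obtain k where k: "(p - 2 * q)\<^sup>2 = 3 ^ 6 * k"
    using three_power_5_dvd_square dvd_def by blast
  have "a = 177 * k - q\<^sup>2" using A_eq a k by simp
  hence a_eq: "a = 3 * (59 * k - i - 1) + 2" by (simp add: ij)
  hence na: "\<not> 3 dvd a" by (rule not_3_dvdI)
  have "B p q = - 2 * A p q - 2 * 3 ^ 5 * (p * q)"
    by (simp add: A_def B_def power2_eq_square algebra_simps)
  hence "b = - 2 * a - 2 * (p * q)" using a b by simp
  hence "b = 3 * (2 * i - 118 * k - 2 * j - 1) + 1" by (simp add: a_eq ij)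
  hence nb: "\<not> 3 dvd b" by (rule not_3_dvdI)

  \<comment> \<open>Both sides of the norm identity carry the factor \<open>3 ^ 10\<close>, because the coordinates
    enter squared.\<close>
  have "5 + nat w * 2 = 10 + nat (2 * w - 5)" using w by simp
  hence "3 ^ 10 * (7 * a\<^sup>2 + 59 * b\<^sup>2) = (3::int) ^ 10 * 3 ^ nat (2 * w - 5)"
    using norm_A_B[of p q]
    by (simp add: a b eq power_mult_distrib power_add flip: power_mult)
  hence "7 * a\<^sup>2 + 59 * b\<^sup>2 = 3 ^ nat (2 * w - 5)" by simp
  hence "pp_solution (\<bar>a\<bar>, \<bar>b\<bar>, 2 * w - 5)"
    using w na nb by (intro pp_solutionI) auto
  moreover have "\<bar>A p q\<bar> div 3 ^ 5 = \<bar>a\<bar>" "\<bar>B p q\<bar> div 3 ^ 5 = \<bar>b\<bar>"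
    by (simp_all add: a b abs_mult)
  ultimately show ?thesis by (simp add: s p_def Let_def del: pp_solution.simps)
qed

section \<open>The sequence and its exponents\<close>

text \<open>Induction along the tree: every index other than 1 and 2 is an odd or an even child of
  a smaller index that is at least 2.\<close>

lemma S_index_induct [consumes 1, case_names one two odd even]:
  fixes n :: nat
  assumes "n \<ge> 1" and "P 1" and "P 2"
    and "\<And>k. k \<ge> 2 \<Longrightarrow> P k \<Longrightarrow> P (2 * k - 1)"
    and "\<And>k. k \<ge> 2 \<Longrightarrow> P k \<Longrightarrow> P (2 * k)"
  shows "P n"
  using assms(1)
proof (induction n rule: less_induct)
  case (less n)
  show ?case
  proof (cases "n \<le> 2")
    case True
    hence "n = 1 \<or> n = 2" using less.prems by auto
    thus ?thesis using assms(2,3) by auto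
  next
    case False
    define k where "k = (n + 1) div 2"
    have k: "k \<ge> 2" "k < n" "n = 2 * k - 1 \<or> n = 2 * k"
      using False by (auto simp: k_def)
    have "P k" using less.IH k by simp
    thus ?thesis using k assms(4,5) by blast
  qed
qed

lemma pp_solution_S: "n \<ge> 1 \<Longrightarrow> pp_solution (S n)"
proof (induction n rule: S_index_induct)
  case one
  show ?case by (simp only: S_1) simp
next
  case two
  show ?case by (simp only: S_2) (simp add: gcd_non_0_int)
next
  case (odd k)
  thus ?case by (simp only: S_odd pp_solution_first_successor)
next
  case (even k)
  thus ?case by (simp only: S_even pp_solution_second_successor)
qed

lemma exponent_first_successor: "snd (snd (first_successor s)) = 2 * snd (snd s) - 5"
  by (cases s) (simp add: Let_def)

lemma exponent_second_successor: "snd (snd (second_successor s)) = 2 * snd (snd s) + 5"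
  by (cases s) (simp add: Let_def)

lemma exponent_S: "n \<ge> 1 \<Longrightarrow> snd (snd (S n)) = 10 * int n - 5"
proof (induction n rule: S_index_induct)
  case one
  show ?case by (simp only: S_1) simp
next
  case two
  show ?case by (simp only: S_2) simp
next
  case (odd k)
  thus ?case by (simp add: S_odd[simplified] exponent_first_successor)
next
  case (even k)
  thus ?case by (simp add: S_even exponent_second_successor)
qed

lemma inj_on_S: "inj_on S {1..}"
proof (rule inj_onI)
  fix i j assume "i \<in> {1..}" "j \<in> {1..}" and eq: "S i = S j"
  hence "i \<ge> 1" "j \<ge> 1" by simp_all
  have "10 * int i - 5 = snd (snd (S i))" using exponent_S[OF \<open>i \<ge> 1\<close>] by (rule sym)
  also have "\<dots> = snd (snd (S j))" by (simp only: eq)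
  also have "\<dots> = 10 * int j - 5" using \<open>j \<ge> 1\<close> by (rule exponent_S)
  finally show "i = j" by linarith
qed

section \<open>The tree of indices\<close>

text \<open>The word is read as in \<open>infinite_binary_tree\<close>: the head of the list is the last child
  step taken.\<close>

definition node_index :: "bool list \<Rightarrow> nat" where
  "node_index w = foldr (\<lambda>b n. if b then 2 * n else 2 * n - 1) w 2"

lemma node_index_Nil [simp]: "node_index [] = 2"
  and node_index_Cons [simp]:
    "node_index (b # w) = (if b then 2 * node_index w else 2 * node_index w - 1)"
  by (simp_all add: node_index_def)

lemma node_index_ge_2: "node_index w \<ge> 2"
  by (induction w) auto

text \<open>The last child step is read off from the parity of the index, and the parent of index
  \<open>n > 2\<close> is \<open>\<lceil>n/2\<rceil>\<close>.\<close>

lemma bij_betw_node_index: "bij_betw node_index UNIV {2..}"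
proof (rule bij_betwI')
  fix v w
  show "node_index v = node_index w \<longleftrightarrow> v = w"
  proof
    assume "node_index v = node_index w"
    thus "v = w"
    proof (induction v arbitrary: w)
      case Nil
      thus ?case
      proof (cases w)
        case (Cons b w')
        thus ?thesis using Nil node_index_ge_2[of w'] by (auto split: if_splits)
      qed simp
    next
      case (Cons a v)
      note v2 = node_index_ge_2[of v]
      show ?case
      proof (cases w)
        case Nil
        thus ?thesis using Cons.prems v2 by (auto split: if_splits)
      next
        case w: (Cons b w')
        have "a = b \<and> node_index v = node_index w'"
          using Cons.prems w v2 node_index_ge_2[of w'] by (auto split: if_splits; presburger)
        thus ?thesis using Cons.IH w by simp
      qed
    qed
  qed simp
next
  fix w show "node_index w \<in> {2..}" by (simp add: node_index_ge_2)
next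
  fix n :: nat assume "n \<in> {2..}"
  hence "n \<ge> 1" "n \<ge> 2" by auto
  thus "\<exists>w\<in>UNIV. n = node_index w"
  proof (induction n rule: S_index_induct)
    case one
    thus ?case by simp
  next
    case two
    show ?case by (intro bexI[of _ "[]"]) auto
  next
    case (odd k)
    then obtain w where "k = node_index w" by auto
    thus ?case by (intro bexI[of _ "False # w"]) auto
  next
    case (even k)
    then obtain w where "k = node_index w" by auto
    thus ?case by (intro bexI[of _ "True # w"]) auto
  qed
qed

lemma foldr_successors_eq_S:
  "foldr (\<lambda>b. if b then second_successor else first_successor) w (S 2) = S (node_index w)"
  by (induction w) (simp_all add: S_odd[simplified] S_even node_index_ge_2)

section \<open>The tree of solutions\<close>

theorem corollary1:
  shows "(\<forall>n\<ge>1. pp_solution (S n)) \<and>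
    inj_on S {1..} \<and>
    infinite_binary_tree (S ` {2..}) (S 2) first_successor second_successor \<and>
    {m. \<exists>n\<ge>1. \<exists>x y. S n = (x, y, m)} = {10 * int k + 5 | k. True} \<and>
    infinite {s. primitive_solution s}"
proof (intro conjI)
  show "\<forall>n\<ge>1. pp_solution (S n)" by (simp add: pp_solution_S)
  show "inj_on S {1..}" by (rule inj_on_S)

  have "inj_on S {2..}" by (rule inj_on_subset[OF inj_on_S]) auto
  hence "bij_betw S {2..} (S ` {2..})" by (rule inj_on_imp_bij_betw)
  hence "bij_betw (S \<circ> node_index) UNIV (S ` {2..})"
    using bij_betw_node_index bij_betw_trans by blast
  thus "infinite_binary_tree (S ` {2..}) (S 2) first_successor second_successor"
    by (simp add: infinite_binary_tree_def foldr_successors_eq_S comp_def)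

  show "{m. \<exists>n\<ge>1. \<exists>x y. S n = (x, y, m)} = {10 * int k + 5 | k. True}"
  proof (intro set_eqI iffI)
    fix m assume "m \<in> {m. \<exists>n\<ge>1. \<exists>x y. S n = (x, y, m)}"
    then obtain n x y where n: "n \<ge> 1" "S n = (x, y, m)" by auto
    hence "m = 10 * int (n - 1) + 5" using exponent_S[of n] by (simp add: of_nat_diff)
    thus "m \<in> {10 * int k + 5 | k. True}" by blast
  next
    fix m assume "m \<in> {10 * int k + 5 | k. True}"
    then obtain k where "m = 10 * int k + 5" by auto
    hence "snd (snd (S (k + 1))) = m" using exponent_S[of "k + 1"] by simp
    hence "S (k + 1) = (fst (S (k + 1)), fst (snd (S (k + 1))), m)" by auto
    thus "m \<in> {m. \<exists>n\<ge>1. \<exists>x y. S n = (x, y, m)}" using le_add2 by blast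
  qed

  have "primitive_solution (S n)" if "n \<ge> 1" for n
    using pp_solution_S[OF that] by (cases "S n") simp
  hence "S ` {1..} \<subseteq> {s. primitive_solution s}" by auto
  moreover have "infinite (S ` {1..})"
    using inj_on_S finite_imageD infinite_Ici by blast
  ultimately show "infinite {s. primitive_solution s}" using finite_subset by blast
qed

end
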